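(* Let $(X,d)$ be a compact metric space, $f_{0,\infty}=\{f_n\}_{n=0}^{\infty}$ a sequence of continuous self-maps of $X$, and $\mathscr F$ a proper Furstenberg family. Then the following are equivalent: $(X,f_{0,\infty})$ is multi-$\mathscr F$-sensitive; $(\mathcal K(X),\bar f_{0,\infty})$ is multi-$\mathscr F$-sensitive; $(\mathcal F^1(X),\tilde f_{0,\infty})$ is multi-$\mathscr F$-sensitive.
   Context: Induced systems: $\mathcal K(X)$ is the set of nonempty compact subsets of $X$ with the Hausdorff metric $D_X$; $\bar f_{0,\infty}=\{\bar f_n\}$, $\bar f_n(A)=f_n(A)$. For upper semicontinuous $u:X\to[0,1]$ let $[u]_\alpha=\{x:u(x)\ge\alpha\}$ for $\alpha\in(0,1]$ and $[u]_0=\overline{\{x:u(x)>0\}}$. $\mathcal F^1(X)$ is the set of upper semicontinuous $u:X\to[0,1]$ with $[u]_\alpha\in\mathcal K(X)$ for all $\alpha\in[0,1]$, with metric $d_\infty(u,v)=\sup_{\alpha\in(0,1]}D_X([u]_\alpha,[v]_\alpha)$. $\tilde f_{0,\infty}=\{\tilde f_n\}$ where $\tilde f_n(u)(x)=\sup_{z\in f_n^{-1}(x)}u(z)$ if $f_n^{-1}(x)\ne\emptyset$, and $0$ otherwise. Furstenberg families: with $\mathbf N$ the set of nonnegative integers, a collection $\mathscr F$ of subsets of $\mathbf N$ is a Furstenberg family if $F_1\subset F_2\subset\mathbf N$ and $F_1\in\mathscr F$ imply $F_2\in\mathscr F$; it is proper if it is a proper subset of the power set of $\mathbf N$, and then $\mathbf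 N\in\mathscr F$, $\emptyset\notin\mathscr F$ (all families are taken to satisfy this). Sensitivity, for a metric space $(Y,\rho)$ with a sequence of continuous self-maps $g_{0,\infty}=\{g_i\}_{i\ge0}$ and $g_0^n=g_{n-1}\circ\cdots\circ g_0$: $N_\rho(x,\epsilon,\delta)$ is the set of integers $n\ge1$ for which there is $y\in Y$ with $\rho(x,y)<\epsilon$ and $\rho(g_0^n(x),g_0^n(y))>\delta$. $(Y,g_{0,\infty})$ is multi-$\mathscr F$-sensitive if there is $\delta>0$ such that $\bigcap_{i=1}^kN_\rho(x_i,\epsilon,\delta)\in\mathscr F$ for all $\epsilon>0$, $k\ge1$ and $x_1,\dots,x_k\in Y$. *)

theory Defs
  imports "HOL-Analysis.Analysis"
begin

section \<open>Furstenberg families\<close>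

definition furstenberg_family :: "nat set set \<Rightarrow> bool" where
  "furstenberg_family \<F> \<longleftrightarrow> (\<forall>F1 F2. F1 \<subseteq> F2 \<longrightarrow> F1 \<in> \<F> \<longrightarrow> F2 \<in> \<F>)"

text \<open>The condition \<open>UNIV \<in> \<F>\<close> excludes the empty collection, which is upward closed and a
  proper subset of the power set; \<open>{} \<notin> \<F>\<close> already follows from upward
  closure and \<open>\<F> \<subset> Pow UNIV\<close>.\<close>

definition proper_furstenberg_family :: "nat set set \<Rightarrow> bool" where
  "proper_furstenberg_family \<F> \<longleftrightarrow>
     furstenberg_family \<F> \<and> \<F> \<subset> Pow UNIV \<and> UNIV \<in> \<F> \<and> {} \<notin> \<F>"

section \<open>Non-autonomous systems and sensitivity\<close>

text \<open>A system is a carrier \<open>Y\<close> with a distance \<open>\<rho>\<close> and a sequence of maps \<open>g\<close>; only the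
  values of \<open>\<rho>\<close> and \<open>g\<close> on \<open>Y\<close> matter when every \<open>g n\<close> maps \<open>Y\<close> into itself.\<close>

primrec nonaut_iter :: "(nat \<Rightarrow> 'b \<Rightarrow> 'b) \<Rightarrow> nat \<Rightarrow> 'b \<Rightarrow> 'b" where
  "nonaut_iter g 0 = id"
| "nonaut_iter g (Suc n) = g n \<circ> nonaut_iter g n"

definition sens_times ::
    "'b set \<Rightarrow> ('b \<Rightarrow> 'b \<Rightarrow> real) \<Rightarrow> (nat \<Rightarrow> 'b \<Rightarrow> 'b) \<Rightarrow> 'b \<Rightarrow> real \<Rightarrow> real \<Rightarrow> nat set" where
  "sens_times Y \<rho> g x \<epsilon> \<delta> =
     {n. n \<ge> 1 \<and> (\<exists>y\<in>Y. \<rho> x y < \<epsilon> \<and> \<rho> (nonaut_iter g n x) (nonaut_iter g n y) > \<delta>)}"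

definition multi_sensitive ::
    "nat set set \<Rightarrow> 'b set \<Rightarrow> ('b \<Rightarrow> 'b \<Rightarrow> real) \<Rightarrow> (nat \<Rightarrow> 'b \<Rightarrow> 'b) \<Rightarrow> bool" where
  "multi_sensitive \<F> Y \<rho> g \<longleftrightarrow>
     (\<exists>\<delta>>0. \<forall>\<epsilon>>0. \<forall>k\<ge>1. \<forall>x::nat \<Rightarrow> 'b. (\<forall>i\<in>{1..k}. x i \<in> Y) \<longrightarrow>
        (\<Inter>i\<in>{1..k}. sens_times Y \<rho> g (x i) \<epsilon> \<delta>) \<in> \<F>)"

section \<open>The hyperspace of nonempty compact sets\<close>

definition hyperspace :: "'a::metric_space set set" where
  "hyperspace = {A. compact A \<and> A \<noteq> {}}"

definition hausdorff_dist :: "'a::metric_space set \<Rightarrow> 'a set \<Rightarrow> real" where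
  "hausdorff_dist A B = max (SUP a\<in>A. infdist a B) (SUP b\<in>B. infdist b A)"

definition hyper_map :: "(nat \<Rightarrow> 'a \<Rightarrow> 'a) \<Rightarrow> nat \<Rightarrow> 'a set \<Rightarrow> 'a set" where
  "hyper_map f n A = f n ` A"

section \<open>The space of normal fuzzy sets\<close>

definition upper_semicontinuous :: "('a::topological_space \<Rightarrow> real) \<Rightarrow> bool" where
  "upper_semicontinuous u \<longleftrightarrow> (\<forall>c. open {x. u x < c})"

text \<open>Only levels \<open>\<alpha> \<in> {0..1}\<close> are meaningful.\<close>

definition level_set :: "('a::topological_space \<Rightarrow> real) \<Rightarrow> real \<Rightarrow> 'a set" where
  "level_set u \<alpha> = (if \<alpha> = 0 then closure {x. u x > 0} else {x. u x \<ge> \<alpha>})"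

definition fuzzy_space :: "('a::metric_space \<Rightarrow> real) set" where
  "fuzzy_space = {u. (\<forall>x. u x \<in> {0..1}) \<and> upper_semicontinuous u \<and>
                     (\<forall>\<alpha>\<in>{0..1}. level_set u \<alpha> \<in> hyperspace)}"

definition fuzzy_dist :: "('a::metric_space \<Rightarrow> real) \<Rightarrow> ('a \<Rightarrow> real) \<Rightarrow> real" where
  "fuzzy_dist u v = (SUP \<alpha>\<in>{0<..1}. hausdorff_dist (level_set u \<alpha>) (level_set v \<alpha>))"

definition fuzzy_map :: "(nat \<Rightarrow> 'a \<Rightarrow> 'a) \<Rightarrow> nat \<Rightarrow> ('a \<Rightarrow> real) \<Rightarrow> 'a \<Rightarrow> real" where
  "fuzzy_map f n u x = (if f n -` {x} \<noteq> {} then SUP z\<in>f n -` {x}. u z else 0)"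

end

theory Submission
  imports Defs
begin

text \<open>
  Points embed isometrically and equivariantly into both induced systems (as singletons and as
  their characteristic functions), so sensitivity descends to \<open>X\<close>. Conversely, if
  \<open>f\<^sub>0\<^sup>n\<close> separates a point from a nearby one by more than \<open>\<delta>\<close>, then one of
  the two is mapped farther than \<open>\<delta>/2\<close> from any prescribed point \<open>p\<close>. Replacing a compact set
  (or a fuzzy set) by a finite approximation and moving each of its points accordingly yields a
  nearby element whose image keeps distance \<open>\<delta>/2\<close> from a prescribed \<open>p\<close> in the image of the
  original one.
\<close>

section \<open>Transfer of multi-sensitivity\<close>

text \<open>The intersection depends only on the set of points and not on their enumeration. With
  finite sets in place of tuples, test sets can be united without reindexing.\<close>

lemma multi_sensitive_finite_iff:
  "multi_sensitive \<F> Y \<rho> g \<longleftrightarrow>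
     (\<exists>\<delta>>0. \<forall>\<epsilon>>0. \<forall>S\<subseteq>Y. finite S \<longrightarrow> S \<noteq> {} \<longrightarrow> (\<Inter>x\<in>S. sens_times Y \<rho> g x \<epsilon> \<delta>) \<in> \<F>)"
proof -
  have key: "(\<forall>k\<ge>1. \<forall>x::nat \<Rightarrow> 'a. (\<forall>i\<in>{1..k}. x i \<in> Y) \<longrightarrow> (\<Inter>i\<in>{1..k}. T (x i)) \<in> \<F>) \<longleftrightarrow>
        (\<forall>S\<subseteq>Y. finite S \<longrightarrow> S \<noteq> {} \<longrightarrow> (\<Inter>x\<in>S. T x) \<in> \<F>)" (is "?L \<longleftrightarrow> ?R")
    for T :: "'a \<Rightarrow> nat set"
  proof
    assume L: ?L
    show ?R
    proof (intro allI impI)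
      fix S assume S: "S \<subseteq> Y" "finite S" "S \<noteq> {}"
      obtain x where x: "bij_betw x {1..card S} S"
        using ex_bij_betw_nat_finite_1[OF S(2)] by blast
      have "card S \<ge> 1" using S by (simp add: Suc_leI card_gt_0_iff)
      moreover have "\<forall>i\<in>{1..card S}. x i \<in> Y"
        using x S(1) by (auto dest: bij_betwE)
      ultimately have "(\<Inter>i\<in>{1..card S}. T (x i)) \<in> \<F>" 
        by (rule L[THEN spec, THEN mp, THEN spec, THEN mp])
      also have "(\<Inter>i\<in>{1..card S}. T (x i)) = \<Inter> (T ` x ` {1..card S})"
        by (simp only: image_image)
      also have "x ` {1..card S} = S" using x by (rule bij_betw_imp_surj_on)
      finally show "(\<Inter>x\<in>S. T x) \<in> \<F>" .
    qed
  next
    assume R: ?R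
    show ?L
    proof (intro allI impI)
      fix k :: nat and x :: "nat \<Rightarrow> 'a" assume k: "1 \<le> k" and x: "\<forall>i\<in>{1..k}. x i \<in> Y"
      have "x ` {1..k} \<subseteq> Y" "finite (x ` {1..k})" "x ` {1..k} \<noteq> {}" using k x by auto
      then have "\<Inter> (T ` x ` {1..k}) \<in> \<F>" using R by blast
      then show "(\<Inter>i\<in>{1..k}. T (x i)) \<in> \<F>" by (simp only: image_image)
    qed
  qed
  show ?thesis
    unfolding multi_sensitive_def key[where T = "\<lambda>x. sens_times Y \<rho> g x \<epsilon> \<delta>" for \<epsilon> \<delta>] ..
qed

text \<open>Reduces sensitivity of the target to one point \<open>w\<close> at a time: it suffices
  to find a finite test set in the source whose common sensitive times are all sensitive times of
  \<open>w\<close>. Finitely many points are then handled by uniting their test sets and using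
  upward closure of the family. The new constant \<open>\<eta> \<delta>\<close> must not depend on
  \<epsilon> or \<open>w\<close>, whereas the test set may.\<close>

lemma multi_sensitive_transfer:
  assumes F: "furstenberg_family \<F>"
    and sens: "multi_sensitive \<F> Y \<rho> g"
    and pos: "\<And>\<delta>::real. \<delta> > 0 \<Longrightarrow> \<eta> \<delta> > 0"
    and cover: "\<And>\<delta> \<epsilon> w. \<delta> > 0 \<Longrightarrow> \<epsilon> > 0 \<Longrightarrow> w \<in> W \<Longrightarrow>
      \<exists>S\<subseteq>Y. finite S \<and> S \<noteq> {} \<and>
        (\<Inter>x\<in>S. sens_times Y \<rho> g x (\<theta> \<epsilon>) \<delta>) \<subseteq> sens_times W \<sigma> h w \<epsilon> (\<eta> \<delta>)"
    and pos': "\<And>\<epsilon>::real. \<epsilon> > 0 \<Longrightarrow> \<theta> \<epsilon> > 0"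
  shows "multi_sensitive \<F> W \<sigma> h"
proof -
  obtain \<delta> where \<delta>: "\<delta> > 0"
    and *: "\<And>\<epsilon> S. \<epsilon> > 0 \<Longrightarrow> S \<subseteq> Y \<Longrightarrow> finite S \<Longrightarrow> S \<noteq> {} \<Longrightarrow>
      (\<Inter>x\<in>S. sens_times Y \<rho> g x \<epsilon> \<delta>) \<in> \<F>"
    using sens[unfolded multi_sensitive_finite_iff] by auto
  have "(\<Inter>w\<in>V. sens_times W \<sigma> h w \<epsilon> (\<eta> \<delta>)) \<in> \<F>"
    if \<epsilon>: "\<epsilon> > 0" and V: "V \<subseteq> W" "finite V" "V \<noteq> {}" for \<epsilon> V
  proof -
    have "\<forall>w\<in>V. \<exists>S. S\<subseteq>Y \<and> finite S \<and> S \<noteq> {} \<and>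
        (\<Inter>x\<in>S. sens_times Y \<rho> g x (\<theta> \<epsilon>) \<delta>) \<subseteq> sens_times W \<sigma> h w \<epsilon> (\<eta> \<delta>)"
      using cover[OF \<delta> \<epsilon>] V(1) by (meson subsetD)
    then obtain S where S: "\<And>w. w \<in> V \<Longrightarrow> S w \<subseteq> Y \<and> finite (S w) \<and> S w \<noteq> {} \<and>
        (\<Inter>x\<in>S w. sens_times Y \<rho> g x (\<theta> \<epsilon>) \<delta>) \<subseteq> sens_times W \<sigma> h w \<epsilon> (\<eta> \<delta>)"
      by metis
    \<comment> \<open>The union of the test sets is again finite and nonempty, so multi-sensitivity
      of the source applies to it once, at scale \<open>\<theta> \<epsilon>\<close>.\<close>
    have "(\<Inter>x\<in>\<Union>(S ` V). sens_times Y \<rho> g x (\<theta> \<epsilon>) \<delta>) \<in> \<F>"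
      using S V by (intro * pos' \<epsilon>) auto
    moreover have "(\<Inter>x\<in>\<Union>(S ` V). sens_times Y \<rho> g x (\<theta> \<epsilon>) \<delta>)
        \<subseteq> (\<Inter>w\<in>V. sens_times W \<sigma> h w \<epsilon> (\<eta> \<delta>))"
      using S by fastforce
    ultimately show ?thesis using F unfolding furstenberg_family_def by blast
  qed
  then show ?thesis unfolding multi_sensitive_finite_iff using pos[OF \<delta>] by blast
qed

text \<open>By the triangle inequality, two images more than \<delta> apart cannot both lie within
  \<delta>/2 of \<open>p\<close>. So \<open>z x\<close> is either the nearby witness or
  \<open>x\<close> itself, and the latter is admissible because \<epsilon> > 0. The point
  \<open>p\<close> and the time \<open>n\<close> are common to all of \<open>S\<close>.\<close>

lemma sens_times_escape:
  fixes f :: "nat \<Rightarrow> 'a::metric_space \<Rightarrow> 'a"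
  assumes n: "n \<in> (\<Inter>x\<in>S. sens_times UNIV dist f x \<epsilon> \<delta>)" and \<epsilon>: "\<epsilon> > 0"
  obtains z where "\<And>x. x \<in> S \<Longrightarrow> dist x (z x) < \<epsilon>"
    and "\<And>x. x \<in> S \<Longrightarrow> dist p (nonaut_iter f n (z x)) > \<delta> / 2"
proof -
  have "\<exists>z. dist x z < \<epsilon> \<and> dist p (nonaut_iter f n z) > \<delta> / 2" if "x \<in> S" for x
  proof -
    have "n \<in> sens_times UNIV dist f x \<epsilon> \<delta>" using n that by blast
    then obtain y where y: "dist x y < \<epsilon>" "dist (nonaut_iter f n x) (nonaut_iter f n y) > \<delta>"
      by (auto simp: sens_times_def)
    have "dist p (nonaut_iter f n x) > \<delta> / 2 \<or> dist p (nonaut_iter f n y) > \<delta> / 2"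
      using y(2) dist_triangle2[of "nonaut_iter f n x" "nonaut_iter f n y" p]
      by (auto simp: dist_commute)
    then show ?thesis using y(1) \<epsilon> by (metis dist_self)
  qed
  then have "\<forall>x\<in>S. \<exists>z. dist x z < \<epsilon> \<and> dist p (nonaut_iter f n z) > \<delta> / 2" by blast
  from bchoice[OF this] obtain z where
    "\<forall>x\<in>S. dist x (z x) < \<epsilon> \<and> dist p (nonaut_iter f n (z x)) > \<delta> / 2" by blast
  then show thesis using that[of z] by blast
qed

section \<open>The Hausdorff distance\<close>

lemma hausdorff_dist_le:
  assumes "A \<noteq> {}" "B \<noteq> {}"
    and "\<And>a. a \<in> A \<Longrightarrow> \<exists>b\<in>B. dist a b \<le> e"
    and "\<And>b. b \<in> B \<Longrightarrow> \<exists>a\<in>A. dist b a \<le> e"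
  shows "hausdorff_dist A B \<le> e"
  unfolding hausdorff_dist_def using assms
  by (auto intro!: cSUP_least intro: infdist_le2)

text \<open>A real supremum dominates its terms only when they are bounded above; the diameter of
  the whole space is a bound that works for all sets.\<close>

lemma bdd_above_infdist:
  fixes A B :: "'a::metric_space set"
  assumes "bounded (UNIV :: 'a set)" "B \<noteq> {}"
  shows "bdd_above ((\<lambda>a. infdist a B) ` A)"
proof -
  obtain b where "b \<in> B" using assms(2) by blast
  then have "infdist a B \<le> diameter (UNIV :: 'a set)" for a
    using diameter_bounded_bound[OF assms(1), of a b] by (auto intro: infdist_le2)
  then show ?thesis by (auto intro!: bdd_aboveI2)
qed

lemma infdist_le_hausdorff_dist:
  fixes A B :: "'a::metric_space set"
  assumes "bounded (UNIV :: 'a set)" "A \<noteq> {}" "B \<noteq> {}"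
  shows "a \<in> A \<Longrightarrow> infdist a B \<le> hausdorff_dist A B"
    and "b \<in> B \<Longrightarrow> infdist b A \<le> hausdorff_dist A B"
proof -
  show "infdist a B \<le> hausdorff_dist A B" if "a \<in> A"
    unfolding hausdorff_dist_def
    using that bdd_above_infdist[OF assms(1,3)] by (intro max.coboundedI1 cSUP_upper)
  show "infdist b A \<le> hausdorff_dist A B" if "b \<in> B"
    unfolding hausdorff_dist_def
    using that bdd_above_infdist[OF assms(1,2)] by (intro max.coboundedI2 cSUP_upper)
qed

text \<open>The supremum over \<open>B\<close> is the farthest distance from \<open>x\<close> to a
  point of \<open>B\<close>, and it dominates the distance from \<open>x\<close> to
  \<open>B\<close>.\<close>

lemma hausdorff_dist_singleton_le_iff:
  fixes B :: "'a::metric_space set"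
  assumes "bounded (UNIV :: 'a set)" "B \<noteq> {}"
  shows "hausdorff_dist {x} B \<le> e \<longleftrightarrow> (\<forall>b\<in>B. dist x b \<le> e)"
proof
  assume "hausdorff_dist {x} B \<le> e"
  then show "\<forall>b\<in>B. dist x b \<le> e"
    using infdist_le_hausdorff_dist(2)[OF assms(1) _ assms(2), of "{x}"]
    by (force simp: dist_commute infdist_singleton)
next
  assume "\<forall>b\<in>B. dist x b \<le> e"
  then show "hausdorff_dist {x} B \<le> e"
    using assms(2) by (intro hausdorff_dist_le) (auto simp: dist_commute)
qed

text \<open>Finiteness of \<open>B\<close> makes the infimum of the distances from \<open>p\<close>
  a minimum, so the strict inequality survives. This is why the perturbed sets are chosen
  finite.\<close>

lemma less_hausdorff_dist_finite:
  fixes A B :: "'a::metric_space set"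
  assumes "bounded (UNIV :: 'a set)" "finite B" "B \<noteq> {}" "p \<in> A"
    and "\<And>b. b \<in> B \<Longrightarrow> e < dist p b"
  shows "e < hausdorff_dist A B"
proof -
  have "e < infdist p B"
    using assms(2,3,5) by (simp add: infdist_notempty finite_less_Inf_iff)
  also have "\<dots> \<le> hausdorff_dist A B"
    using assms by (intro infdist_le_hausdorff_dist) auto
  finally show ?thesis .
qed

section \<open>The base system and the hyperspace system\<close>

lemma nonaut_iter_hyper_map: "nonaut_iter (hyper_map f) n A = nonaut_iter f n ` A"
  by (induction n) (auto simp: hyper_map_def image_image)

lemma multi_sensitive_hyper:
  fixes f :: "nat \<Rightarrow> 'a::metric_space \<Rightarrow> 'a"
  assumes bdd: "bounded (UNIV :: 'a set)" and F: "furstenberg_family \<F>"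
    and sens: "multi_sensitive \<F> UNIV dist f"
  shows "multi_sensitive \<F> hyperspace hausdorff_dist (hyper_map f)"
\<comment> \<open>Half of \<delta> is lost in \<open>sens_times_escape\<close>. Net radius and
  displacement, each \<epsilon>/4, add up to \<epsilon>/2; the slack turns the weak bound of
  \<open>hausdorff_dist_le\<close> into a strict one below \<epsilon>.\<close>
proof (rule multi_sensitive_transfer[OF F sens, where \<eta> = "\<lambda>\<delta>. \<delta> / 2" and \<theta> = "\<lambda>\<epsilon>. \<epsilon> / 4"])
  fix \<delta> \<epsilon> :: real and A :: "'a set"
  assume \<delta>: "\<delta> > 0" and \<epsilon>: "\<epsilon> > 0" and "A \<in> hyperspace"
  then have A: "compact A" "A \<noteq> {}" unfolding hyperspace_def by auto
  \<comment> \<open>The net is taken inside \<open>A\<close>, so that the moved points stay close to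
    \<open>A\<close> as well.\<close>
  obtain S where S: "finite S" "S \<subseteq> A" "A \<subseteq> (\<Union>x\<in>S. ball x (\<epsilon> / 4))"
    using compactE_image[OF A(1), of A "\<lambda>x. ball x (\<epsilon> / 4)"] \<epsilon> by force
  have S0: "S \<noteq> {}" using A S by auto
  have "n \<in> sens_times hyperspace hausdorff_dist (hyper_map f) A \<epsilon> (\<delta> / 2)"
    if n: "n \<in> (\<Inter>x\<in>S. sens_times UNIV dist f x (\<epsilon> / 4) \<delta>)" for n
  proof -
    obtain a where a: "a \<in> A" using A by blast
    obtain z where z: "\<And>x. x \<in> S \<Longrightarrow> dist x (z x) < \<epsilon> / 4"
      "\<And>x. x \<in> S \<Longrightarrow> dist (nonaut_iter f n a) (nonaut_iter f n (z x)) > \<delta> / 2"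
      using sens_times_escape[OF n] \<epsilon> by (metis zero_less_divide_iff zero_less_numeral)
    have "hausdorff_dist A (z ` S) \<le> \<epsilon> / 2"
    proof (rule hausdorff_dist_le)
      fix a assume "a \<in> A"
      then obtain x where x: "x \<in> S" "dist x a < \<epsilon> / 4" using S(3) by auto
      have "dist a (z x) \<le> \<epsilon> / 2"
        using dist_triangle[of a "z x" x] z(1)[OF x(1)] x(2) by (simp add: dist_commute)
      then show "\<exists>b\<in>z ` S. dist a b \<le> \<epsilon> / 2" using x(1) by blast
    next
      fix b assume "b \<in> z ` S"
      then obtain x where x: "x \<in> S" "b = z x" by blast
      have "dist b x \<le> \<epsilon> / 2" using z(1)[OF x(1)] x(2) \<epsilon> by (simp add: dist_commute)
      then show "\<exists>a\<in>A. dist b a \<le> \<epsilon> / 2" using x(1) S(2) by blast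
    qed (use A S0 in auto)
    moreover have "z ` S \<in> hyperspace"
      unfolding hyperspace_def using S(1) S0 by (simp add: finite_imp_compact)
    moreover have "\<delta> / 2 < hausdorff_dist (nonaut_iter f n ` A) (nonaut_iter f n ` z ` S)"
      using bdd S(1) S0 a z(2)
      by (intro less_hausdorff_dist_finite[where p = "nonaut_iter f n a"]) auto
    moreover have "n \<ge> 1" using n S0 unfolding sens_times_def by blast
    ultimately show ?thesis
      unfolding sens_times_def nonaut_iter_hyper_map using \<epsilon>
      by (auto intro!: bexI[of _ "z ` S"])
  qed
  then show "\<exists>S\<subseteq>UNIV. finite S \<and> S \<noteq> {} \<and> (\<Inter>x\<in>S. sens_times UNIV dist f x (\<epsilon> / 4) \<delta>)
      \<subseteq> sens_times hyperspace hausdorff_dist (hyper_map f) A \<epsilon> (\<delta> / 2)"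
    using S(1) S0 by blast
qed auto

text \<open>The test set is the single element \<open>{x}\<close>. Every point of a set close to
  \<open>{x}\<close> is close to \<open>x\<close>, and if the images are more than \<delta> apart,
  some point of the set realises this. No constant is lost.\<close>

lemma multi_sensitive_of_hyper:
  fixes f :: "nat \<Rightarrow> 'a::metric_space \<Rightarrow> 'a"
  assumes bdd: "bounded (UNIV :: 'a set)" and F: "furstenberg_family \<F>"
    and sens: "multi_sensitive \<F> hyperspace hausdorff_dist (hyper_map f)"
  shows "multi_sensitive \<F> UNIV dist f"
proof (rule multi_sensitive_transfer[OF F sens, where \<eta> = "\<lambda>\<delta>. \<delta>" and \<theta> = "\<lambda>\<epsilon>. \<epsilon>"])
  fix \<delta> \<epsilon> :: real and x :: 'a
  assume \<delta>: "\<delta> > 0" and \<epsilon>: "\<epsilon> > 0"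
  have "n \<in> sens_times UNIV dist f x \<epsilon> \<delta>"
    if n: "n \<in> sens_times hyperspace hausdorff_dist (hyper_map f) {x} \<epsilon> \<delta>" for n
  proof -
    obtain B where B: "B \<in> hyperspace" "hausdorff_dist {x} B < \<epsilon>"
      "\<delta> < hausdorff_dist {nonaut_iter f n x} (nonaut_iter f n ` B)" and n1: "n \<ge> 1"
      using n unfolding sens_times_def nonaut_iter_hyper_map by auto
    have B0: "B \<noteq> {}" using B(1) unfolding hyperspace_def by simp
    obtain b where b: "b \<in> B" "\<delta> < dist (nonaut_iter f n x) (nonaut_iter f n b)"
      using B(3) B0 hausdorff_dist_singleton_le_iff[OF bdd, of "nonaut_iter f n ` B"]
      by (auto simp: not_le[symmetric])
    have "dist x b < \<epsilon>"
      using hausdorff_dist_singleton_le_iff[OF bdd B0, of x "hausdorff_dist {x} B"] b(1) B(2)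
      by force
    then show ?thesis unfolding sens_times_def using n1 b(2) by blast
  qed
  then show "\<exists>S\<subseteq>hyperspace. finite S \<and> S \<noteq> {} \<and>
      (\<Inter>A\<in>S. sens_times hyperspace hausdorff_dist (hyper_map f) A \<epsilon> \<delta>)
      \<subseteq> sens_times UNIV dist f x \<epsilon> \<delta>"
    by (intro exI[of _ "{{x}}"]) (auto simp: hyperspace_def)
qed auto

section \<open>Normal fuzzy sets\<close>

text \<open>If no maximum existed, the open sets where \<open>u\<close> is below \<open>u w\<close>,
  for \<open>w\<close> in \<open>K\<close>, would cover \<open>K\<close>. In a finite subcover, the
  index with the largest value would lie in none of its members.\<close>

lemma upper_semicontinuous_attains_sup:
  assumes u: "upper_semicontinuous u" and K: "compact K" "K \<noteq> {}"
  shows "\<exists>m\<in>K. \<forall>z\<in>K. u z \<le> u m"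
proof (rule ccontr)
  assume "\<not> ?thesis"
  then have "\<And>m. m \<in> K \<Longrightarrow> \<exists>z\<in>K. u m < u z" by (meson not_le)
  then have "K \<subseteq> (\<Union>w\<in>K. {x. u x < u w})" by blast
  then obtain C where C: "C \<subseteq> K" "finite C" "K \<subseteq> (\<Union>w\<in>C. {x. u x < u w})"
    using compactE_image[OF K(1), of K "\<lambda>w. {x. u x < u w}"] u
    unfolding upper_semicontinuous_def by metis
  have "C \<noteq> {}" using C K by auto
  then have "Max (u ` C) \<in> u ` C" using C(2) by (intro Max_in) auto
  then obtain w where w: "w \<in> C" "u w = Max (u ` C)" by auto
  obtain w' where "w' \<in> C" "u w < u w'" using w(1) C by blast
  then show False using w(2) C(2) Max_ge[of "u ` C" "u w'"] by (simp add: not_le[symmetric])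
qed

lemma level_set_pos: "\<alpha> > 0 \<Longrightarrow> level_set u \<alpha> = {x. u x \<ge> \<alpha>}"
  by (simp add: level_set_def)

text \<open>On a compact space closed levels are compact, and a point of grade 1 lies in every
  level, including the closure at level 0. Sublevel sets for \<open>c\<close> outside (0,1] are
  empty or everything, so only positive levels need checking.\<close>

lemma fuzzy_space_iff:
  fixes u :: "'a::metric_space \<Rightarrow> real"
  assumes cpt: "compact (UNIV :: 'a set)"
  shows "u \<in> fuzzy_space \<longleftrightarrow>
    (\<forall>x. u x \<in> {0..1}) \<and> (\<forall>\<alpha>\<in>{0<..1}. closed {x. u x \<ge> \<alpha>}) \<and> (\<exists>x. u x = 1)"
proof
  assume u: "u \<in> fuzzy_space"
  have "closed {x. u x \<ge> \<alpha>}" for \<alpha>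
  proof -
    have "{x. u x \<ge> \<alpha>} = - {x. u x < \<alpha>}" by auto
    then show ?thesis
      using u unfolding fuzzy_space_def upper_semicontinuous_def by (simp add: closed_Compl)
  qed
  moreover have "\<exists>x. u x = 1"
  proof -
    have "level_set u 1 \<noteq> {}" using u unfolding fuzzy_space_def hyperspace_def by auto
    then show ?thesis using u unfolding fuzzy_space_def level_set_def
      by (auto intro: antisym)
  qed
  ultimately show "(\<forall>x. u x \<in> {0..1}) \<and> (\<forall>\<alpha>\<in>{0<..1}. closed {x. u x \<ge> \<alpha>}) \<and> (\<exists>x. u x = 1)"
    using u unfolding fuzzy_space_def by blast
next
  assume u: "(\<forall>x. u x \<in> {0..1}) \<and> (\<forall>\<alpha>\<in>{0<..1}. closed {x. u x \<ge> \<alpha>}) \<and> (\<exists>x. u x = 1)"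
  then have range: "0 \<le> u x" "u x \<le> 1" for x by auto
  have "open {x. u x < c}" for c
  proof -
    consider "c \<le> 0" | "c > 1" | "c \<in> {0<..1}" by fastforce
    then show ?thesis
    proof cases
      case 1
      then have "{x. u x < c} = {}" using range(1) by (auto simp: not_less intro: order_trans)
      then show ?thesis by simp
    next
      case 2
      then have "{x. u x < c} = UNIV" using range(2) by (auto intro: le_less_trans)
      then show ?thesis by simp
    next
      case 3
      have "{x. u x < c} = - {x. u x \<ge> c}" by auto
      then show ?thesis using 3 u by (simp add: open_Compl)
    qed
  qed
  then have usc: "upper_semicontinuous u" unfolding upper_semicontinuous_def by blast
  obtain x where x: "u x = 1" using u by blast
  have "level_set u \<alpha> \<in> hyperspace" if \<alpha>: "\<alpha> \<in> {0..1}" for \<alpha>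
  proof -
    have "closed (level_set u \<alpha>)"
      using \<alpha> u unfolding level_set_def by auto
    then have "compact (level_set u \<alpha>)"
      using cpt compact_Int_closed by fastforce
    moreover have "x \<in> level_set u \<alpha>"
      using \<alpha> x closure_subset[of "{x. u x > 0}"] unfolding level_set_def by auto
    ultimately show ?thesis unfolding hyperspace_def by blast
  qed
  then show "u \<in> fuzzy_space" using u usc unfolding fuzzy_space_def by blast
qed

lemma level_set_nonempty:
  assumes "u \<in> fuzzy_space" "\<alpha> \<in> {0<..1}"
  shows "level_set u \<alpha> \<noteq> {}"
  using assms unfolding fuzzy_space_def hyperspace_def by auto

section \<open>Level sets under the Zadeh extension\<close>

text \<open>The fibre is closed by continuity, hence compact, so the supremum in the Zadeh extension
  is a maximum.\<close>

lemma fuzzy_map_attained: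
  fixes f :: "nat \<Rightarrow> 'a::metric_space \<Rightarrow> 'a"
  assumes cpt: "compact (UNIV :: 'a set)" and cont: "continuous_on UNIV (f n)"
    and u: "u \<in> fuzzy_space" and ne: "f n -` {x} \<noteq> {}"
  obtains m where "f n m = x" "fuzzy_map f n u x = u m" "\<And>z. f n z = x \<Longrightarrow> u z \<le> u m"
proof -
  have "closed (f n -` {x})"
    using continuous_closed_vimage[of "{x}" "f n"] cont
    by (simp add: continuous_on_eq_continuous_within)
  then have "compact (f n -` {x})" using cpt compact_Int_closed by fastforce
  moreover have "upper_semicontinuous u" using u unfolding fuzzy_space_def by blast
  ultimately obtain m where m: "m \<in> f n -` {x}" "\<And>z. z \<in> f n -` {x} \<Longrightarrow> u z \<le> u m"
    using upper_semicontinuous_attains_sup[of u "f n -` {x}"] ne by blast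
  then have "(SUP z\<in>f n -` {x}. u z) = u m" by (intro cSup_eq_maximum) auto
  then show thesis using that[of m] m ne unfolding fuzzy_map_def by auto
qed

text \<open>Attainment gives the inclusion from left to right: a grade of at least \<alpha> must
  come from an actual preimage. Positivity of \<alpha> rules out the default value 0 on empty
  fibres; \<open>fuzzy_dist\<close> looks at positive levels only.\<close>

lemma level_set_fuzzy_map:
  fixes f :: "nat \<Rightarrow> 'a::metric_space \<Rightarrow> 'a"
  assumes cpt: "compact (UNIV :: 'a set)" and cont: "continuous_on UNIV (f n)"
    and u: "u \<in> fuzzy_space" and \<alpha>: "\<alpha> > 0"
  shows "level_set (fuzzy_map f n u) \<alpha> = f n ` level_set u \<alpha>"
proof (intro set_eqI iffI)
  fix x assume "x \<in> level_set (fuzzy_map f n u) \<alpha>"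
  then have x: "fuzzy_map f n u x \<ge> \<alpha>" using \<alpha> by (simp add: level_set_pos)
  then have "f n -` {x} \<noteq> {}" using \<alpha> unfolding fuzzy_map_def by (auto split: if_splits)
  then obtain m where "f n m = x" "fuzzy_map f n u x = u m"
    using fuzzy_map_attained[where f = f and n = n, OF cpt cont u] by metis
  then show "x \<in> f n ` level_set u \<alpha>" using x \<alpha> by (auto simp: level_set_pos)
next
  fix x assume "x \<in> f n ` level_set u \<alpha>"
  then obtain z where z: "x = f n z" "u z \<ge> \<alpha>" using \<alpha> by (auto simp: level_set_pos)
  then have "f n -` {x} \<noteq> {}" by blast
  then obtain m where "fuzzy_map f n u x = u m" "\<And>z. f n z = x \<Longrightarrow> u z \<le> u m"
    using fuzzy_map_attained[where f = f and n = n, OF cpt cont u] by metis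
  then show "x \<in> level_set (fuzzy_map f n u) \<alpha>" using z \<alpha> by (force simp: level_set_pos)
qed

lemma fuzzy_map_in_fuzzy_space:
  fixes f :: "nat \<Rightarrow> 'a::metric_space \<Rightarrow> 'a"
  assumes cpt: "compact (UNIV :: 'a set)" and cont: "continuous_on UNIV (f n)"
    and u: "u \<in> fuzzy_space"
  shows "fuzzy_map f n u \<in> fuzzy_space"
proof -
  have range: "u x \<in> {0..1}" for x using u unfolding fuzzy_space_def by blast
  have range': "fuzzy_map f n u x \<in> {0..1}" for x
  proof (cases "f n -` {x} = {}")
    case True
    then show ?thesis unfolding fuzzy_map_def by simp
  next
    case False
    then obtain m where "fuzzy_map f n u x = u m"
      using fuzzy_map_attained[where f = f and n = n, OF cpt cont u] by metis
    then show ?thesis using range by simp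
  qed
  have "closed {x. fuzzy_map f n u x \<ge> \<alpha>}" if \<alpha>: "\<alpha> \<in> {0<..1}" for \<alpha>
  proof -
    have "compact (level_set u \<alpha>)"
      using u \<alpha> unfolding fuzzy_space_def hyperspace_def by auto
    then have "compact (f n ` level_set u \<alpha>)"
      using cont by (meson compact_continuous_image continuous_on_subset subset_UNIV)
    then show ?thesis
      using level_set_fuzzy_map[where f = f and n = n, OF cpt cont u, of \<alpha>] \<alpha>
      by (simp add: level_set_pos compact_imp_closed)
  qed
  moreover have "\<exists>x. fuzzy_map f n u x = 1"
  proof -
    obtain z where "z \<in> level_set u 1" using level_set_nonempty[OF u, of 1] by auto
    then have "f n z \<in> level_set (fuzzy_map f n u) 1"
      using level_set_fuzzy_map[where f = f and n = n, OF cpt cont u, of 1] by simp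
    then have "fuzzy_map f n u (f n z) \<ge> 1" by (simp add: level_set_pos)
    then show ?thesis using range'[of "f n z"] by (intro exI[of _ "f n z"]) auto
  qed
  ultimately show ?thesis using range' unfolding fuzzy_space_iff[OF cpt] by blast
qed

text \<open>The two claims share one induction, since the level formula for the next map requires
  the current iterate to lie in \<open>fuzzy_space\<close>.\<close>

lemma level_set_nonaut_iter_fuzzy_map:
  fixes f :: "nat \<Rightarrow> 'a::metric_space \<Rightarrow> 'a"
  assumes cpt: "compact (UNIV :: 'a set)" and cont: "\<And>n. continuous_on UNIV (f n)"
    and u: "u \<in> fuzzy_space"
  shows "nonaut_iter (fuzzy_map f) n u \<in> fuzzy_space"
    and "\<alpha> > 0 \<Longrightarrow>
      level_set (nonaut_iter (fuzzy_map f) n u) \<alpha> = nonaut_iter f n ` level_set u \<alpha>"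
proof (induction n)
  case (Suc n)
  { case 1
    show ?case using fuzzy_map_in_fuzzy_space[where f = f and n = n, OF cpt cont Suc.IH(1)] by simp
  next
    case 2
    then show ?case
      using level_set_fuzzy_map[where f = f and n = n, OF cpt cont Suc.IH(1) 2] Suc.IH(2)[OF 2]
      by (simp add: image_comp) }
qed (use u in auto)

section \<open>The supremum distance and finite approximation of fuzzy sets\<close>

lemma hausdorff_dist_level_set_le_fuzzy_dist:
  fixes u v :: "'a::metric_space \<Rightarrow> real"
  assumes bdd: "bounded (UNIV :: 'a set)"
    and u: "u \<in> fuzzy_space" and v: "v \<in> fuzzy_space" and \<alpha>: "\<alpha> \<in> {0<..1}"
  shows "hausdorff_dist (level_set u \<alpha>) (level_set v \<alpha>) \<le> fuzzy_dist u v"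
proof -
  have "hausdorff_dist (level_set u \<alpha>) (level_set v \<alpha>) \<le> diameter (UNIV :: 'a set)"
    if "\<alpha> \<in> {0<..1}" for \<alpha>
    using level_set_nonempty[OF u that] level_set_nonempty[OF v that]
      diameter_bounded_bound[OF bdd]
    by (intro hausdorff_dist_le) auto
  then have "bdd_above ((\<lambda>\<alpha>. hausdorff_dist (level_set u \<alpha>) (level_set v \<alpha>)) ` {0<..1})"
    by (rule bdd_aboveI2)
  then show ?thesis unfolding fuzzy_dist_def using \<alpha> by (intro cSUP_upper)
qed

lemma fuzzy_dist_le:
  assumes "\<And>\<alpha>. \<alpha> \<in> {0<..1} \<Longrightarrow> hausdorff_dist (level_set u \<alpha>) (level_set v \<alpha>) \<le> e"
  shows "fuzzy_dist u v \<le> e"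
  unfolding fuzzy_dist_def using assms by (intro cSUP_least) auto

text \<open>One net has to serve all levels at once. Each ball of a finite cover contributes a point
  where \<open>u\<close> is maximal on the closed ball; a point of that ball then has a net point
  within \<open>r\<close> that belongs to every positive level containing it.\<close>

lemma fuzzy_finite_net:
  fixes u :: "'a::metric_space \<Rightarrow> real"
  assumes cpt: "compact (UNIV :: 'a set)" and u: "u \<in> fuzzy_space" and r: "r > 0"
  obtains S where "finite S" "\<And>a. \<exists>x\<in>S. dist a x \<le> r \<and> u a \<le> u x"
proof -
  have r2: "r / 2 > 0" using r by simp
  obtain C :: "'a set" where C: "finite C" "UNIV \<subseteq> (\<Union>c\<in>C. ball c (r / 2))"
    using cpt r2 unfolding compact_eq_totally_bounded by blast
  have "\<exists>m\<in>cball c (r / 2). \<forall>z\<in>cball c (r / 2). u z \<le> u m" for c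
  proof -
    have "compact (cball c (r / 2))"
      using cpt compact_Int_closed[OF cpt closed_cball, of c "r / 2"] by simp
    moreover have "cball c (r / 2) \<noteq> {}" using r2 by (metis centre_in_cball empty_iff less_imp_le)
    moreover have "upper_semicontinuous u" using u unfolding fuzzy_space_def by blast
    ultimately show ?thesis by (intro upper_semicontinuous_attains_sup)
  qed
  then obtain m where m: "\<And>c. m c \<in> cball c (r / 2)"
    "\<And>c z. z \<in> cball c (r / 2) \<Longrightarrow> u z \<le> u (m c)"
    by metis
  have "\<exists>x\<in>m ` C. dist a x \<le> r \<and> u a \<le> u x" for a
  proof -
    obtain c where c: "c \<in> C" "dist c a < r / 2" using C(2)[THEN subsetD, of a] by auto
    have "dist a (m c) \<le> r"
      using dist_triangle[of a "m c" c] m(1)[of c] c(2) by (simp add: dist_commute)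
    moreover have "u a \<le> u (m c)" using m(2)[of a c] c(2) by simp
    ultimately show ?thesis using c(1) by blast
  qed
  then show thesis using that[of "m ` C"] C(1) by blast
qed

text \<open>The Zadeh extension along \<open>z\<close> of the restriction of \<open>u\<close> to \<open>S\<close>; the inserted \<open>0\<close> is the
  value on empty fibres.\<close>

definition finite_fuzzy :: "'a set \<Rightarrow> ('a \<Rightarrow> 'a) \<Rightarrow> ('a \<Rightarrow> real) \<Rightarrow> 'a \<Rightarrow> real" where
  "finite_fuzzy S z u y = Max (insert 0 (u ` {x \<in> S. z x = y}))"

lemma finite_fuzzy_ge_iff:
  assumes "finite S" "\<alpha> > 0"
  shows "finite_fuzzy S z u y \<ge> \<alpha> \<longleftrightarrow> (\<exists>x\<in>S. z x = y \<and> u x \<ge> \<alpha>)"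
  unfolding finite_fuzzy_def using assms by (subst Max_ge_iff) auto

lemma level_set_finite_fuzzy:
  assumes "finite S" "\<alpha> > 0"
  shows "level_set (finite_fuzzy S z u) \<alpha> = z ` {x \<in> S. u x \<ge> \<alpha>}"
  using finite_fuzzy_ge_iff[OF assms, of z u] assms(2) by (auto simp: level_set_pos)

lemma finite_fuzzy_in_fuzzy_space:
  fixes u :: "'a::metric_space \<Rightarrow> real"
  assumes cpt: "compact (UNIV :: 'a set)" and S: "finite S"
    and range: "\<And>x. u x \<in> {0..1}" and one: "x \<in> S" "u x = 1"
  shows "finite_fuzzy S z u \<in> fuzzy_space"
proof -
  have range': "finite_fuzzy S z u y \<in> {0..1}" for y
    unfolding finite_fuzzy_def using S range by (auto simp: Max_le_iff)
  have "closed {y. finite_fuzzy S z u y \<ge> \<alpha>}" if "\<alpha> \<in> {0<..1}" for \<alpha>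
    using level_set_finite_fuzzy[OF S, of \<alpha> z u] that S
    by (simp add: level_set_pos finite_imp_closed)
  moreover have "finite_fuzzy S z u (z x) \<ge> 1"
    using one by (subst finite_fuzzy_ge_iff[OF S]) auto
  then have "\<exists>y. finite_fuzzy S z u y = 1"
    using range'[of "z x"] by (intro exI[of _ "z x"]) auto
  ultimately show ?thesis using range' unfolding fuzzy_space_iff[OF cpt] by blast
qed

section \<open>The base system and the fuzzy system\<close>

lemma multi_sensitive_fuzzy:
  fixes f :: "nat \<Rightarrow> 'a::metric_space \<Rightarrow> 'a"
  assumes cpt: "compact (UNIV :: 'a set)" and cont: "\<And>n. continuous_on UNIV (f n)"
    and F: "furstenberg_family \<F>" and sens: "multi_sensitive \<F> UNIV dist f"
  shows "multi_sensitive \<F> fuzzy_space fuzzy_dist (fuzzy_map f)"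
proof (rule multi_sensitive_transfer[OF F sens, where \<eta> = "\<lambda>\<delta>. \<delta> / 2" and \<theta> = "\<lambda>\<epsilon>. \<epsilon> / 4"])
  fix \<delta> \<epsilon> :: real and u :: "'a \<Rightarrow> real"
  assume \<delta>: "\<delta> > 0" and \<epsilon>: "\<epsilon> > 0" and u: "u \<in> fuzzy_space"
  have bdd: "bounded (UNIV :: 'a set)" using cpt by (rule compact_imp_bounded)
  have range: "u x \<in> {0..1}" for x using u unfolding fuzzy_space_def by blast
  obtain a where a: "u a = 1" using u unfolding fuzzy_space_iff[OF cpt] by blast
  obtain S where S: "finite S" "\<And>a. \<exists>x\<in>S. dist a x \<le> \<epsilon> / 4 \<and> u a \<le> u x"
    using fuzzy_finite_net[OF cpt u, of "\<epsilon> / 4"] \<epsilon> by (metis zero_less_divide_iff zero_less_numeral)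
  \<comment> \<open>A net point dominating \<open>a\<close> has grade exactly 1. It makes the
    perturbed fuzzy set normal and shows that \<open>S\<close> is nonempty.\<close>
  obtain x0 where x0: "x0 \<in> S" "u x0 = 1"
    using S(2)[of a] a range by (metis antisym atLeastAtMost_iff)
  have "n \<in> sens_times fuzzy_space fuzzy_dist (fuzzy_map f) u \<epsilon> (\<delta> / 2)"
    if n: "n \<in> (\<Inter>x\<in>S. sens_times UNIV dist f x (\<epsilon> / 4) \<delta>)" for n
  proof -
    obtain z where z: "\<And>x. x \<in> S \<Longrightarrow> dist x (z x) < \<epsilon> / 4"
      "\<And>x. x \<in> S \<Longrightarrow> dist (nonaut_iter f n a) (nonaut_iter f n (z x)) > \<delta> / 2"
      using sens_times_escape[OF n] \<epsilon> by (metis zero_less_divide_iff zero_less_numeral)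
    \<comment> \<open>Each net point carries its grade along to \<open>z x\<close>, the larger grade
      winning in a collision. Positive levels of \<open>v\<close> are thus finite sets of displaced
      net points.\<close>
    define v where "v = finite_fuzzy S z u"
    have v: "v \<in> fuzzy_space"
      unfolding v_def using cpt S(1) range x0 by (rule finite_fuzzy_in_fuzzy_space)
    have lv: "level_set v \<alpha> = z ` {x \<in> S. u x \<ge> \<alpha>}" if "\<alpha> > 0" for \<alpha>
      unfolding v_def using S(1) that by (rule level_set_finite_fuzzy)
    have "fuzzy_dist u v \<le> \<epsilon> / 2"
    proof (intro fuzzy_dist_le hausdorff_dist_le)
      fix \<alpha> :: real and a assume \<alpha>: "\<alpha> \<in> {0<..1}" and "a \<in> level_set u \<alpha>"
      then have "u a \<ge> \<alpha>" by (simp add: level_set_pos)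
      then obtain x where x: "x \<in> S" "dist a x \<le> \<epsilon> / 4" "u x \<ge> \<alpha>"
        using S(2)[of a] by force
      have "dist a (z x) \<le> \<epsilon> / 2"
        using dist_triangle[of a "z x" x] z(1)[OF x(1)] x(2) by simp
      then show "\<exists>b\<in>level_set v \<alpha>. dist a b \<le> \<epsilon> / 2" using x lv \<alpha> by auto
    next
      fix \<alpha> :: real and b assume \<alpha>: "\<alpha> \<in> {0<..1}" and "b \<in> level_set v \<alpha>"
      then obtain x where x: "x \<in> S" "u x \<ge> \<alpha>" "b = z x" using lv by auto
      have "dist b x \<le> \<epsilon> / 2" using z(1)[OF x(1)] x(3) \<epsilon> by (simp add: dist_commute)
      then show "\<exists>a\<in>level_set u \<alpha>. dist b a \<le> \<epsilon> / 2" using x(2) \<alpha> by (auto simp: level_set_pos)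
    qed (use level_set_nonempty u v in blast)+
    moreover have "\<delta> / 2 < fuzzy_dist (nonaut_iter (fuzzy_map f) n u) (nonaut_iter (fuzzy_map f) n v)"
    proof -
      note lev = level_set_nonaut_iter_fuzzy_map[where f = f, OF cpt cont]
      \<comment> \<open>Level 1 alone suffices: it contains \<open>a\<close> for \<open>u\<close>,
        and for \<open>v\<close> it is finite, nonempty by \<open>x0\<close>, and mapped away from
        the image of \<open>a\<close>.\<close>
      have "\<delta> / 2 < hausdorff_dist (nonaut_iter f n ` level_set u 1) (nonaut_iter f n ` level_set v 1)"
        using bdd S(1) x0 a z(2) lv[of 1]
        by (intro less_hausdorff_dist_finite[where p = "nonaut_iter f n a"])
          (auto simp: level_set_pos)
      also have "\<dots> \<le> fuzzy_dist (nonaut_iter (fuzzy_map f) n u) (nonaut_iter (fuzzy_map f) n v)"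
        using hausdorff_dist_level_set_le_fuzzy_dist[OF bdd lev(1)[OF u] lev(1)[OF v], of 1 n n]
          lev(2)[OF u, of 1 n] lev(2)[OF v, of 1 n] by simp
      finally show ?thesis .
    qed
    moreover have "n \<ge> 1" using n x0 unfolding sens_times_def by blast
    ultimately show ?thesis
      unfolding sens_times_def using \<epsilon> v by (auto intro!: bexI[of _ v])
  qed
  then show "\<exists>S\<subseteq>UNIV. finite S \<and> S \<noteq> {} \<and> (\<Inter>x\<in>S. sens_times UNIV dist f x (\<epsilon> / 4) \<delta>)
      \<subseteq> sens_times fuzzy_space fuzzy_dist (fuzzy_map f) u \<epsilon> (\<delta> / 2)"
    using S(1) x0(1) by blast
qed auto

text \<open>The test set is the characteristic function of \<open>x\<close>, whose positive levels
  are all \<open>{x}\<close>. This reduces the claim, level by level, to Hausdorff distances from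
  singletons.\<close>

lemma multi_sensitive_of_fuzzy:
  fixes f :: "nat \<Rightarrow> 'a::metric_space \<Rightarrow> 'a"
  assumes cpt: "compact (UNIV :: 'a set)" and cont: "\<And>n. continuous_on UNIV (f n)"
    and F: "furstenberg_family \<F>"
    and sens: "multi_sensitive \<F> fuzzy_space fuzzy_dist (fuzzy_map f)"
  shows "multi_sensitive \<F> UNIV dist f"
proof (rule multi_sensitive_transfer[OF F sens, where \<eta> = "\<lambda>\<delta>. \<delta>" and \<theta> = "\<lambda>\<epsilon>. \<epsilon>"])
  fix \<delta> \<epsilon> :: real and x :: 'a
  assume \<delta>: "\<delta> > 0" and \<epsilon>: "\<epsilon> > 0"
  have bdd: "bounded (UNIV :: 'a set)" using cpt by (rule compact_imp_bounded)
  define u :: "'a \<Rightarrow> real" where "u = indicator {x}"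
  have lu: "level_set u \<alpha> = {x}" if "\<alpha> \<in> {0<..1}" for \<alpha>
    using that unfolding u_def by (auto simp: level_set_pos indicator_def split: if_splits)
  have u: "u \<in> fuzzy_space"
    unfolding fuzzy_space_iff[OF cpt]
  proof (intro conjI ballI allI)
    fix \<alpha> :: real assume "\<alpha> \<in> {0<..1}"
    then show "closed {y. u y \<ge> \<alpha>}" using lu[of \<alpha>] by (simp add: level_set_pos)
  qed (auto simp: u_def indicator_def)
  note lev = level_set_nonaut_iter_fuzzy_map[where f = f, OF cpt cont]
  have "n \<in> sens_times UNIV dist f x \<epsilon> \<delta>"
    if n: "n \<in> sens_times fuzzy_space fuzzy_dist (fuzzy_map f) u \<epsilon> \<delta>" for n
  proof -
    obtain v where v: "v \<in> fuzzy_space" "fuzzy_dist u v < \<epsilon>"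
      "\<delta> < fuzzy_dist (nonaut_iter (fuzzy_map f) n u) (nonaut_iter (fuzzy_map f) n v)"
      and n1: "n \<ge> 1"
      using n unfolding sens_times_def by auto
    \<comment> \<open>A supremum above \<delta> is exceeded already at some level. Closeness of
      \<open>u\<close> and \<open>v\<close> holds at every level, so the level found from the images
      can be used at time 0 too.\<close>
    have "\<not> (\<forall>\<alpha>\<in>{0<..1}. hausdorff_dist (level_set (nonaut_iter (fuzzy_map f) n u) \<alpha>)
                                  (level_set (nonaut_iter (fuzzy_map f) n v) \<alpha>) \<le> \<delta>)"
      using v(3) fuzzy_dist_le[of "nonaut_iter (fuzzy_map f) n u" "nonaut_iter (fuzzy_map f) n v" \<delta>]
      by fastforce
    then obtain \<alpha> where \<alpha>: "\<alpha> \<in> {0<..1}"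
      "\<delta> < hausdorff_dist (level_set (nonaut_iter (fuzzy_map f) n u) \<alpha>)
                        (level_set (nonaut_iter (fuzzy_map f) n v) \<alpha>)"
      by (auto simp: not_le)
    then have *: "\<delta> < hausdorff_dist {nonaut_iter f n x} (nonaut_iter f n ` level_set v \<alpha>)"
      using lev(2)[OF u, of \<alpha> n] lev(2)[OF v(1), of \<alpha> n] lu by simp
    have ne: "level_set v \<alpha> \<noteq> {}" using v(1) \<alpha>(1) by (rule level_set_nonempty)
    obtain b where b: "b \<in> level_set v \<alpha>" "\<delta> < dist (nonaut_iter f n x) (nonaut_iter f n b)"
      using * ne hausdorff_dist_singleton_le_iff[OF bdd, of "nonaut_iter f n ` level_set v \<alpha>"]
      by (auto simp: not_le[symmetric])
    have "hausdorff_dist {x} (level_set v \<alpha>) \<le> fuzzy_dist u v"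
      using hausdorff_dist_level_set_le_fuzzy_dist[OF bdd u v(1) \<alpha>(1)] lu[OF \<alpha>(1)] by simp
    then have "dist x b < \<epsilon>"
      using hausdorff_dist_singleton_le_iff[OF bdd ne, of x "fuzzy_dist u v"] b(1) v(2) by force
    then show ?thesis unfolding sens_times_def using n1 b(2) by blast
  qed
  then show "\<exists>S\<subseteq>fuzzy_space. finite S \<and> S \<noteq> {} \<and>
      (\<Inter>w\<in>S. sens_times fuzzy_space fuzzy_dist (fuzzy_map f) w \<epsilon> \<delta>)
      \<subseteq> sens_times UNIV dist f x \<epsilon> \<delta>"
    using u by (intro exI[of _ "{u}"]) auto
qed auto

theorem theorem5p3:
  fixes f :: "nat \<Rightarrow> 'a::metric_space \<Rightarrow> 'a"
    and \<F> :: "nat set set"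
  assumes "compact (UNIV :: 'a set)"
    and "\<And>n. continuous_on UNIV (f n)"
    and "proper_furstenberg_family \<F>"
  shows "(multi_sensitive \<F> UNIV dist f
            \<longleftrightarrow> multi_sensitive \<F> hyperspace hausdorff_dist (hyper_map f)) \<and>
         (multi_sensitive \<F> hyperspace hausdorff_dist (hyper_map f)
            \<longleftrightarrow> multi_sensitive \<F> fuzzy_space fuzzy_dist (fuzzy_map f))"
proof -
  have F: "furstenberg_family \<F>" using assms(3) unfolding proper_furstenberg_family_def by blast
  have bdd: "bounded (UNIV :: 'a set)" using assms(1) by (rule compact_imp_bounded)
  show ?thesis
  proof (intro conjI iffI)
    assume "multi_sensitive \<F> UNIV dist f"
    then show "multi_sensitive \<F> hyperspace hausdorff_dist (hyper_map f)"
      by (rule multi_sensitive_hyper[OF bdd F])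
  next
    assume "multi_sensitive \<F> hyperspace hausdorff_dist (hyper_map f)"
    then show "multi_sensitive \<F> UNIV dist f"
      by (rule multi_sensitive_of_hyper[OF bdd F])
    then show "multi_sensitive \<F> fuzzy_space fuzzy_dist (fuzzy_map f)"
      by (rule multi_sensitive_fuzzy[OF assms(1,2) F])
  next
    assume "multi_sensitive \<F> fuzzy_space fuzzy_dist (fuzzy_map f)"
    then have "multi_sensitive \<F> UNIV dist f"
      by (rule multi_sensitive_of_fuzzy[OF assms(1,2) F])
    then show "multi_sensitive \<F> hyperspace hausdorff_dist (hyper_map f)"
      by (rule multi_sensitive_hyper[OF bdd F])
  qed
qed

end
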